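(* Let $X$ be $\mathbb{R}$ or a nondegenerate interval in $\mathbb{R}$, with its usual topology, and let $f : X \to X$ be a continuous topologically transitive map. Then the set $P$ of periodic points of $f$ is dense in $X$ and has empty interior in $X$. Consequently, $P \setminus P_n$ is dense in $X$ for every positive integer $n$.
   Context: A point $x \in X$ is periodic if $f^{n}(x)=x$ for some positive integer $n$, where $f^n$ is the $n$-fold composition of $f$; the smallest such $n$ is the period of $x$. $P$ denotes the set of all periodic points of $f$, and for a positive integer $n$, $P_n$ denotes the set of all periodic points of period $\le n$. The map $f$ is topologically transitive if for any two non-empty open sets $V, W \subseteq X$ there is a positive integer $n$ with $f^{n}(V) \cap W \neq \emptyset$. *)

theory Defs
  imports "HOL-Analysis.Analysis"
begin

definition periodic_points :: "'a set \<Rightarrow> ('a \<Rightarrow> 'a) \<Rightarrow> 'a set" where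
  "periodic_points X f = {x \<in> X. \<exists>n>0. (f ^^ n) x = x}"

text \<open>Only meaningful when x is a periodic point of f.\<close>

definition period :: "('a \<Rightarrow> 'a) \<Rightarrow> 'a \<Rightarrow> nat" where
  "period f x = (LEAST n. n > 0 \<and> (f ^^ n) x = x)"

definition periodic_points_upto :: "'a set \<Rightarrow> ('a \<Rightarrow> 'a) \<Rightarrow> nat \<Rightarrow> 'a set" where
  "periodic_points_upto X f n = {x \<in> periodic_points X f. period f x \<le> n}"

definition topologically_transitive :: "'a topology \<Rightarrow> ('a \<Rightarrow> 'a) \<Rightarrow> bool" where
  "topologically_transitive T f \<longleftrightarrow>
    (\<forall>V W. openin T V \<longrightarrow> openin T W \<longrightarrow> V \<noteq> {} \<longrightarrow> W \<noteq> {} \<longrightarrow>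
      (\<exists>n>0. (f ^^ n) ` V \<inter> W \<noteq> {}))"

end

theory Submission
  imports Defs
begin

text \<open>Density: let \<open>J\<close> be an interval without periodic points, \<open>f\<^sup>M y \<in> J\<close> for some \<open>y \<in> J\<close>, and
  let \<open>U \<subseteq> J\<close> be a small interval around \<open>y\<close> disjoint from its first \<open>M\<close> iterates. A point
  \<open>z \<in> U\<close> that returns to \<open>U\<close> does so at a time \<open>n > M\<close>; but the visits of an orbit to \<open>J\<close> are
  monotone in time, so \<open>f\<^sup>M z\<close> lies between \<open>z\<close> and \<open>f\<^sup>n z\<close>, hence in \<open>U\<close>, a contradiction.
  Empty interior: by Baire, if periodic points fill an open set then some \<open>f\<^sup>n\<close> is the identity on an
  open set \<open>S\<close>, and a neighbourhood of \<open>x \<in> S\<close> then never reaches a neighbourhood of a point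
  \<open>y \<in> S\<close> outside the finite orbit of \<open>x\<close>. Finally, \<open>P\<^sub>n\<close> lies in the closed, nowhere dense set
  of fixed points of the iterate with exponent \<open>n!\<close>.\<close>

section \<open>Iterates of a self-map\<close>

lemma funpow_mem:
  assumes "f \<in> X \<rightarrow> X" "x \<in> X"
  shows "(f ^^ n) x \<in> X"
  using assms by (induction n) auto

lemma continuous_on_funpow:
  assumes "f \<in> X \<rightarrow> X" "continuous_on X f"
  shows "continuous_on X (f ^^ n)"
proof (induction n)
  case 0
  show ?case by (simp add: id_def)
next
  case (Suc n)
  have "(f ^^ n) ` X \<subseteq> X"
    using funpow_mem[OF assms(1)] by blast
  then have "continuous_on ((f ^^ n) ` X) f"
    using assms(2) continuous_on_subset by blast
  with Suc show ?case
    using continuous_on_compose by auto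
qed

lemma funpow_fixpoint_mult:
  assumes "(f ^^ n) x = x"
  shows "(f ^^ (n * k)) x = x"
  using assms by (induction k) (simp_all add: funpow_add)

section \<open>Monotone returns to an interval free of periodic points\<close>

lemma continuous_on_reflect:
  fixes g :: "real \<Rightarrow> real"
  assumes "continuous_on X g"
  shows "continuous_on (uminus ` X) (\<lambda>x. - g (- x))"
proof -
  have "continuous_on (uminus ` X) (\<lambda>x. g (- x))"
    by (rule continuous_on_compose2[OF assms]) (auto intro: continuous_intros)
  then show ?thesis by (rule continuous_on_minus)
qed

text \<open>Induction with the intermediate value theorem: the first iterate that falls back to
  \<open>z\<close> or below would make \<open>g ^^ k\<close> push \<open>z\<close> up and
  \<open>g z\<close> down, so \<open>g ^^ k\<close> would have a fixed point between them.\<close>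

lemma iterates_stay_above:
  fixes g :: "real \<Rightarrow> real"
  assumes "g \<in> X \<rightarrow> X" "continuous_on X g" "{z..g z} \<subseteq> X" "z < g z"
    and nofix: "\<And>x k. z \<le> x \<Longrightarrow> x \<le> g z \<Longrightarrow> k > 0 \<Longrightarrow> (g ^^ k) x \<noteq> x"
  shows "k > 0 \<Longrightarrow> z < (g ^^ k) z"
proof (induction k)
  case (Suc k)
  show ?case
  proof (cases "k = 0")
    case True
    with assms show ?thesis by simp
  next
    case False
    show ?thesis
    proof (rule ccontr)
      assume "\<not> ?thesis"
      then have le: "(g ^^ k) (g z) \<le> z"
        by (simp add: funpow_swap1)
      have "continuous_on {z..g z} (g ^^ k)"
        using continuous_on_subset[OF continuous_on_funpow[OF assms(1,2)] assms(3)] .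
      then have "continuous_on {z..g z} (\<lambda>x. (g ^^ k) x - x)"
        by (intro continuous_intros)
      \<comment> \<open>The difference is positive at \<open>z\<close> by the induction hypothesis
        and negative at \<open>g z\<close>, since
        \<open>(g ^^ k) (g z) \<le> z < g z\<close>.\<close>
      then obtain x where "z \<le> x" "x \<le> g z" "(g ^^ k) x - x = 0"
        using IVT2'[of "\<lambda>x. (g ^^ k) x - x" "g z" 0 z] le Suc False assms(4) by auto
      with nofix False show False by auto
    qed
  qed
qed simp

text \<open>Mirror image of \<open>iterates_stay_above\<close>, obtained by conjugating
  \<open>g\<close> with the reflection of the line at 0.\<close>

lemma iterates_stay_below:
  fixes g :: "real \<Rightarrow> real"
  assumes "g \<in> X \<rightarrow> X" "continuous_on X g" "{g z..z} \<subseteq> X" "g z < z"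
    and nofix: "\<And>x k. g z \<le> x \<Longrightarrow> x \<le> z \<Longrightarrow> k > 0 \<Longrightarrow> (g ^^ k) x \<noteq> x"
    and "k > 0"
  shows "(g ^^ k) z < z"
proof -
  define h where "h x = - g (- x)" for x
  have pow: "(h ^^ k) x = - (g ^^ k) (- x)" for k x
    by (induction k) (simp_all add: h_def)
  have "continuous_on (uminus ` X) h"
    unfolding h_def using assms(2) by (rule continuous_on_reflect)
  moreover have "{- z..h (- z)} \<subseteq> uminus ` X"
  proof
    fix x assume "x \<in> {- z..h (- z)}"
    then have "- x \<in> {g z..z}" by (auto simp: h_def)
    then show "x \<in> uminus ` X" using assms(3) by force
  qed
  ultimately have "- z < (h ^^ k) (- z)"
    using assms
    by (intro iterates_stay_above[of h "uminus ` X"]) (auto simp: pow h_def)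
  then show ?thesis by (simp add: pow)
qed

text \<open>If the orbit rose from \<open>z\<close> to \<open>w\<close> in \<open>m\<close> steps
  and then did not rise in the next \<open>d\<close>, then \<open>f ^^ m\<close> would move
  \<open>z\<close> up and \<open>f ^^ d\<close> would move \<open>w\<close> down. Iterating these
  maps \<open>d\<close> and \<open>m\<close> times compares both points under the common iterate
  \<open>f ^^ (m * d)\<close>, which then has a fixed point between them.\<close>

lemma returns_increasing:
  fixes f :: "real \<Rightarrow> real"
  assumes f: "f \<in> X \<rightarrow> X" "continuous_on X f"
    and J: "J \<subseteq> X" "is_interval J" "J \<inter> periodic_points X f = {}"
    and mem: "z \<in> J" "(f ^^ m) z \<in> J" "(f ^^ n) z \<in> J"
    and mn: "0 < m" "m < n" and less: "z < (f ^^ m) z"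
  shows "(f ^^ m) z < (f ^^ n) z"
proof (rule ccontr)
  define w where "w = (f ^^ m) z"
  define d where "d = n - m"
  have d: "d > 0" and fw: "(f ^^ d) w = (f ^^ n) z"
    using mn by (auto simp: d_def w_def simp flip: funpow_add o_apply[of "f ^^ _" "f ^^ _"])
  have np: "(f ^^ k) x \<noteq> x" if "x \<in> J" "k > 0" for x k
    using J that by (auto simp: periodic_points_def)
  have sub: "{a..b} \<subseteq> J" if "a \<in> J" "b \<in> J" for a b
    using J(2) that by (meson atLeastAtMost_iff mem_is_interval_1_I subsetI)
  have g: "f ^^ k \<in> X \<rightarrow> X" "continuous_on X (f ^^ k)" for k
    using funpow_mem[OF f(1)] continuous_on_funpow[OF f] by auto
  have pow: "((f ^^ i) ^^ k) x = (f ^^ (i * k)) x" for i k x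
    by (simp add: funpow_mult)
  assume "\<not> (f ^^ m) z < (f ^^ n) z"
  \<comment> \<open>Equality is excluded because \<open>w\<close> would be a periodic point in
    \<open>J\<close>.\<close>
  moreover have "(f ^^ d) w \<noteq> w"
    using np mem(2) d by (auto simp: w_def)
  ultimately have gt: "(f ^^ d) w < w"
    using fw by (simp add: w_def)
  have "((f ^^ d) ^^ m) w < w"
  proof (rule iterates_stay_below[OF g _ gt _ mn(1)])
    show "{(f ^^ d) w..w} \<subseteq> X"
      using sub mem(2,3) J(1) fw by (auto simp: w_def)
    fix x and k :: nat assume "(f ^^ d) w \<le> x" "x \<le> w" "k > 0"
    then show "((f ^^ d) ^^ k) x \<noteq> x"
      using sub[OF mem(3,2)] fw d np[of x "d * k"] by (auto simp: pow w_def)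
  qed
  moreover have "z < ((f ^^ m) ^^ d) z"
  proof (rule iterates_stay_above[OF g _ less _ d])
    show "{z..(f ^^ m) z} \<subseteq> X"
      using sub mem J(1) by blast
    fix x and k :: nat assume "z \<le> x" "x \<le> (f ^^ m) z" "k > 0"
    then show "((f ^^ m) ^^ k) x \<noteq> x"
      using sub[OF mem(1,2)] mn np[of x "m * k"] by (auto simp: pow)
  qed
  moreover have "continuous_on {z..w} (\<lambda>x. (f ^^ (m * d)) x - x)"
    using sub[OF mem(1,2)] J(1) unfolding w_def
    by (intro continuous_intros continuous_on_subset[OF g(2)]) auto
  \<comment> \<open>The two preceding inequalities give the sign change of this difference on
    \<open>{z..w}\<close>.\<close>
  ultimately obtain x where "z \<le> x" "x \<le> w" "(f ^^ (m * d)) x - x = 0"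
    using IVT2'[of "\<lambda>x. (f ^^ (m * d)) x - x" w 0 z] less
    by (auto simp: pow w_def mult.commute)
  then show False
    using np[of x "m * d"] sub[OF mem(1,2)] mn d by (auto simp: w_def)
qed

text \<open>Follows from \<open>returns_increasing\<close> by the same reflection, which carries
  \<open>J\<close> to an interval free of periodic points of \<open>h\<close>.\<close>

lemma returns_decreasing:
  fixes f :: "real \<Rightarrow> real"
  assumes f: "f \<in> X \<rightarrow> X" "continuous_on X f"
    and J: "J \<subseteq> X" "is_interval J" "J \<inter> periodic_points X f = {}"
    and mem: "z \<in> J" "(f ^^ m) z \<in> J" "(f ^^ n) z \<in> J"
    and mn: "0 < m" "m < n" and less: "(f ^^ m) z < z"
  shows "(f ^^ n) z < (f ^^ m) z"
proof -
  define h where "h x = - f (- x)" for x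
  have pow: "(h ^^ k) x = - (f ^^ k) (- x)" for k x
    by (induction k) (simp_all add: h_def)
  have "continuous_on (uminus ` X) h"
    unfolding h_def using f(2) by (rule continuous_on_reflect)
  moreover have "uminus ` J \<inter> periodic_points (uminus ` X) h = {}"
    using J(3) by (fastforce simp: periodic_points_def pow)
  moreover have "is_interval (uminus ` J)"
    using J(2) by simp
  ultimately have "(h ^^ m) (- z) < (h ^^ n) (- z)"
    using f J mem mn less
    by (intro returns_increasing[of h "uminus ` X" "uminus ` J"]) (auto simp: pow h_def)
  then show ?thesis by (simp add: pow)
qed

section \<open>Small neighbourhoods and relatively open sets\<close>

lemma eventually_ball_disjoint_image:
  fixes g :: "'a::metric_space \<Rightarrow> 'b::metric_space"
  assumes "continuous_on X g" "x \<in> X" "g x \<noteq> y"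
  shows "\<forall>\<^sub>F e in at_right 0. \<forall>u\<in>X \<inter> ball x e. g u \<notin> ball y e"
proof -
  \<comment> \<open>Half the distance: a point within \<open>r\<close> of both \<open>g x\<close>
    and \<open>y\<close> would violate the triangle inequality.\<close>
  define r where "r = dist (g x) y / 2"
  have "r > 0" using assms(3) by (simp add: r_def)
  then obtain s where s: "s > 0" "\<And>u. u \<in> X \<Longrightarrow> dist u x < s \<Longrightarrow> dist (g u) (g x) < r"
    using assms(1,2) unfolding continuous_on_iff by blast
  have "\<forall>u\<in>X \<inter> ball x e. g u \<notin> ball y e" if "0 < e" "e < min r s" for e
  proof
    fix u assume "u \<in> X \<inter> ball x e"
    then have "dist (g u) (g x) < r"
      using s that by (auto simp: dist_commute)
    then show "g u \<notin> ball y e"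
      using that dist_triangle[of "g x" y "g u"] by (auto simp: r_def dist_commute)
  qed
  then show ?thesis
    using \<open>r > 0\<close> \<open>s > 0\<close> by (intro eventually_at_rightI[of 0 "min r s"]) auto
qed

lemma eventually_ball_subset:
  assumes "open S" "x \<in> S"
  shows "\<forall>\<^sub>F e in at_right 0. ball x e \<subseteq> S"
proof -
  obtain e where "e > 0" "ball x e \<subseteq> S"
    using assms openE by blast
  then show ?thesis
    by (intro eventually_at_rightI[of 0 e]) auto
qed

text \<open>Allows passing from relatively open sets, which may cling to an endpoint of
  \<open>X\<close>, to intervals of the line. A nondegenerate interval has no isolated points, so
  \<open>V\<close> holds two points of \<open>X\<close> close enough together that the segment
  between them stays in \<open>V\<close>.\<close>

lemma openin_interval_contains_Icc:
  fixes X V :: "real set"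
  assumes "is_interval X" "\<exists>a\<in>X. \<exists>b\<in>X. a < b" "openin (top_of_set X) V" "V \<noteq> {}"
  obtains c d where "c < d" "{c..d} \<subseteq> V"
proof -
  obtain x where "x \<in> V" using assms(4) by blast
  then have "x \<in> X" using assms(3) openin_imp_subset by blast
  obtain e where e: "e > 0" "ball x e \<inter> X \<subseteq> V"
    using assms(3) \<open>x \<in> V\<close> by (auto simp: openin_contains_ball)
  have "x islimpt X"
    using assms(1,2) \<open>x \<in> X\<close> is_interval_connected by (intro connected_imp_perfect) auto
  then obtain y where y: "y \<in> X" "y \<noteq> x" "dist y x < e"
    using e(1) by (auto simp: islimpt_approachable)
  have "is_interval (ball x e \<inter> X)"
    using assms(1) by (intro is_interval_Int) (auto simp: is_interval_ball_real)
  moreover have "x \<in> ball x e \<inter> X" "y \<in> ball x e \<inter> X"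
    using e y \<open>x \<in> X\<close> by (auto simp: dist_commute)
  then have "min x y \<in> ball x e \<inter> X" "max x y \<in> ball x e \<inter> X"
    by (simp_all only: min_def max_def split: if_split) simp_all
  ultimately have "{min x y..max x y} \<subseteq> ball x e \<inter> X"
    by (meson atLeastAtMost_iff mem_is_interval_1_I subsetI)
  with e(2) y(2) show ?thesis
    by (intro that[of "min x y" "max x y"]) auto
qed

lemma topologically_transitiveE:
  fixes X V W :: "'a::topological_space set"
  assumes "topologically_transitive (top_of_set X) f"
    and "open V" "V \<subseteq> X" "V \<noteq> {}" "open W" "W \<subseteq> X" "W \<noteq> {}"
  obtains n z where "n > 0" "z \<in> V" "(f ^^ n) z \<in> W"
proof -
  have "openin (top_of_set X) V" "openin (top_of_set X) W"
    using assms by (simp_all add: open_subset)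
  then have "\<exists>n>0. (f ^^ n) ` V \<inter> W \<noteq> {}"
    using assms unfolding topologically_transitive_def by blast
  then show ?thesis using that by blast
qed

section \<open>Periodic points in every open interval\<close>

lemma transitive_interval_has_periodic_point:
  fixes X :: "real set"
  assumes f: "f \<in> X \<rightarrow> X" "continuous_on X f"
    and trans: "topologically_transitive (top_of_set X) f"
    and cd: "c < d" "{c<..<d} \<subseteq> X"
  shows "{c<..<d} \<inter> periodic_points X f \<noteq> {}"
proof
  define J where "J = {c<..<d}"
  assume "{c<..<d} \<inter> periodic_points X f = {}"
  then have J: "J \<subseteq> X" "is_interval J" "J \<inter> periodic_points X f = {}" "open J" "J \<noteq> {}"
    using cd by (auto simp: J_def)
  obtain M y where M: "M > 0" "y \<in> J" "(f ^^ M) y \<in> J"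
    using topologically_transitiveE[OF trans, of J J] J by metis
  have "\<forall>\<^sub>F e in at_right 0. \<forall>i\<in>{1..M}. \<forall>u\<in>X \<inter> ball y e. (f ^^ i) u \<notin> ball y e"
  proof (intro eventually_ball_finite ballI eventually_ball_disjoint_image)
    fix i assume "i \<in> {1..M}"
    then have "i > 0" by simp
    moreover have "y \<in> X" "y \<notin> periodic_points X f"
      using J(1,3) M(2) by blast+
    ultimately show "(f ^^ i) y \<noteq> y"
      unfolding periodic_points_def by blast
  qed (use J M continuous_on_funpow[OF f] in blast)+
  moreover have "\<forall>\<^sub>F e in at_right 0. ball y e \<subseteq> J"
    using eventually_ball_subset J M by blast
  \<comment> \<open>By continuity the points near \<open>y\<close> share its visit to
    \<open>J\<close> at time \<open>M\<close>; this supplies the intermediate visit for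
    monotonicity.\<close>
  moreover have "\<forall>\<^sub>F e in at_right 0. \<forall>u\<in>X \<inter> ball y e. (f ^^ M) u \<in> J"
  proof -
    obtain T where T: "open T" "T \<inter> X = (f ^^ M) -` J \<inter> X"
      using continuous_on_open_invariant[THEN iffD1, OF continuous_on_funpow[OF f]] J(4) by metis
    then have "y \<in> T" using M J by auto
    with T have "\<forall>\<^sub>F e in at_right 0. ball y e \<subseteq> T"
      using eventually_ball_subset by blast
    then show ?thesis
      by eventually_elim (use T in blast)
  qed
  moreover have "\<forall>\<^sub>F e in at_right (0::real). e > 0"
    by (simp add: eventually_at_right_less)
  ultimately have "\<forall>\<^sub>F e in at_right 0. e > 0 \<and> ball y e \<subseteq> J
      \<and> (\<forall>u\<in>X \<inter> ball y e. (f ^^ M) u \<in> J)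
      \<and> (\<forall>i\<in>{1..M}. \<forall>u\<in>X \<inter> ball y e. (f ^^ i) u \<notin> ball y e)"
    by eventually_elim blast
  then obtain e where e: "e > 0" "ball y e \<subseteq> J" "\<forall>u\<in>X \<inter> ball y e. (f ^^ M) u \<in> J"
      "\<forall>i\<in>{1..M}. \<forall>u\<in>X \<inter> ball y e. (f ^^ i) u \<notin> ball y e"
    using eventually_happens'[of "at_right (0::real)"] trivial_limit_at_right_real by blast
  obtain n z where n: "n > 0" "z \<in> ball y e" "(f ^^ n) z \<in> ball y e"
    using topologically_transitiveE[OF trans, of "ball y e" "ball y e"] e J(1)
    by (metis ball_eq_empty not_le open_ball order_trans)
  have z: "z \<in> X \<inter> ball y e" using n e J by blast
  have "n > M"
    using e(4) n z by (metis One_nat_def Suc_leI atLeastAtMost_iff not_le)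
  have inJ: "z \<in> J" "(f ^^ M) z \<in> J" "(f ^^ n) z \<in> J"
    using z e n by auto
  have notin: "(f ^^ M) z \<notin> ball y e"
    using e(4) z M by auto
  \<comment> \<open>Either strict direction of the first move fixes that of the second, so
    \<open>(f ^^ M) z\<close> is caught between two points of the ball.\<close>
  then have "(f ^^ M) z \<noteq> z" using n by auto
  then have "z < (f ^^ M) z \<and> (f ^^ M) z < (f ^^ n) z \<or> (f ^^ M) z < z \<and> (f ^^ n) z < (f ^^ M) z"
    using returns_increasing[OF f J(1-3) inJ M(1) \<open>n > M\<close>]
      returns_decreasing[OF f J(1-3) inJ M(1) \<open>n > M\<close>] by linarith
  with n have "(f ^^ M) z \<in> ball y e"
    by (auto simp: dist_real_def)
  with notin show False ..
qed

section \<open>Empty interior of the set of periodic points\<close>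

lemma transitive_iterate_not_id_on_open:
  fixes X S :: "'a::{metric_space, perfect_space} set"
  assumes f: "f \<in> X \<rightarrow> X" "continuous_on X f"
    and trans: "topologically_transitive (top_of_set X) f"
    and S: "open S" "S \<subseteq> X" "S \<noteq> {}" and "n > 0"
    and fix_n: "\<And>x. x \<in> S \<Longrightarrow> (f ^^ n) x = x"
  shows False
proof -
  obtain x where x: "x \<in> S" using S by blast
  \<comment> \<open>A nonempty open set in a perfect space is infinite, which leaves room for
    \<open>y\<close> off the orbit of \<open>x\<close>.\<close>
  have "infinite S"
    using S(1) x islimpt_UNIV[of x] unfolding islimpt_eq_acc_point by (metis inf_top_right)
  then have "S - (\<lambda>i. (f ^^ i) x) ` {..<n} \<noteq> {}"
    by (intro infinite_imp_nonempty) simp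
  then obtain y where y: "y \<in> S" "\<And>i. i < n \<Longrightarrow> (f ^^ i) x \<noteq> y"
    by blast
  have "\<forall>\<^sub>F e in at_right 0. \<forall>i\<in>{..<n}. \<forall>u\<in>X \<inter> ball x e. (f ^^ i) u \<notin> ball y e"
    using S x y continuous_on_funpow[OF f]
    by (intro eventually_ball_finite ballI eventually_ball_disjoint_image) auto
  moreover have "\<forall>\<^sub>F e in at_right (0::real). e > 0"
    by (simp add: eventually_at_right_less)
  ultimately have "\<forall>\<^sub>F e in at_right 0. e > 0 \<and>
      (\<forall>i\<in>{..<n}. \<forall>u\<in>X \<inter> ball x e. (f ^^ i) u \<notin> ball y e)"
    by eventually_elim blast
  then obtain e where e: "e > 0" "\<forall>i\<in>{..<n}. \<forall>u\<in>X \<inter> ball x e. (f ^^ i) u \<notin> ball y e"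
    using eventually_happens'[of "at_right (0::real)"] trivial_limit_at_right_real by blast
  \<comment> \<open>Intersecting with \<open>S\<close> ensures that \<open>f ^^ n\<close> fixes the
    starting point \<open>z\<close>, so the hitting time can be reduced modulo
    \<open>n\<close>.\<close>
  have "x \<in> S \<inter> ball x e" "y \<in> S \<inter> ball y e" using x y e by auto
  then obtain k z where k: "z \<in> S \<inter> ball x e" "(f ^^ k) z \<in> S \<inter> ball y e"
    using topologically_transitiveE[OF trans, of "S \<inter> ball x e" "S \<inter> ball y e"] S
    by (metis empty_iff inf.coboundedI1 open_Int open_ball)
  have "(f ^^ k) z = (f ^^ (k mod n)) z"
    using k fix_n by (simp add: funpow_mod_eq)
  then show False
    using e(2) k S \<open>n > 0\<close> by (metis IntD1 IntD2 IntI lessThan_iff mod_less_divisor subsetD)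
qed

lemma transitive_not_all_periodic:
  fixes X :: "real set"
  assumes f: "f \<in> X \<rightarrow> X" "continuous_on X f"
    and trans: "topologically_transitive (top_of_set X) f"
    and cd: "c < d" "{c..d} \<subseteq> X"
  shows "\<not> {c..d} \<subseteq> periodic_points X f"
proof
  assume sub: "{c..d} \<subseteq> periodic_points X f"
  define F where "F n = {x\<in>{c..d}. (f ^^ n) x = x}" for n
  have closed: "closed (F n)" for n
  proof -
    have "continuous_on {c..d} (f ^^ n)"
      using continuous_on_subset[OF continuous_on_funpow[OF f] cd(2)] .
    then have "continuous_on {c..d} (\<lambda>x. (f ^^ n) x - x)"
      by (intro continuous_intros)
    from continuous_closed_preimage_constant[OF this closed_atLeastAtMost, of 0]
    show ?thesis by (simp add: F_def)
  qed
  have "interior (F n) = {}" if "n > 0" for n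
  proof (rule ccontr)
    assume "interior (F n) \<noteq> {}"
    moreover have "interior (F n) \<subseteq> F n" by (rule interior_subset)
    ultimately show False
      using transitive_iterate_not_id_on_open[OF f trans open_interior _ _ that, of "F n"] cd(2)
      by (force simp: F_def)
  qed
  \<comment> \<open>The index 0 must be left out: \<open>f ^^ 0\<close> is the identity, so
    \<open>F 0\<close> is all of \<open>{c..d}\<close>.\<close>
  then have "euclideanreal interior_of \<Union>(F ` {0<..}) = {}"
  proof (intro Baire_category_alt)
    show "completely_metrizable_space euclideanreal \<or>
        locally_compact_space euclideanreal \<and> regular_space euclideanreal"
      using completely_metrizable_space_euclidean by blast
  qed (use closed in auto)
  moreover have "{c<..<d} \<subseteq> \<Union>(F ` {0<..})"
  proof
    fix x assume x: "x \<in> {c<..<d}"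
    then have "x \<in> periodic_points X f" using sub by auto
    then obtain n where "n > 0" "(f ^^ n) x = x"
      unfolding periodic_points_def by blast
    with x show "x \<in> \<Union>(F ` {0<..})" by (auto simp: F_def)
  qed
  then have "{c<..<d} \<subseteq> interior (\<Union>(F ` {0<..}))"
    by (intro interior_maximal) auto
  ultimately show False using cd(1) by simp
qed

section \<open>Points of bounded period\<close>

lemma funpow_period:
  assumes "x \<in> periodic_points X f"
  shows "period f x > 0" "(f ^^ period f x) x = x"
proof -
  have "\<exists>n. n > 0 \<and> (f ^^ n) x = x"
    using assms by (auto simp: periodic_points_def)
  then have "period f x > 0 \<and> (f ^^ period f x) x = x"
    unfolding period_def by (rule LeastI_ex)
  then show "period f x > 0" "(f ^^ period f x) x = x" by auto
qed

text \<open>The factorial is a common multiple of all periods from 1 to \<open>n\<close>, so one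
  iterate fixes all these points.\<close>

lemma periodic_points_upto_subset:
  "periodic_points_upto X f n \<subseteq> {x\<in>X. (f ^^ fact n) x = x}"
proof
  fix x assume "x \<in> periodic_points_upto X f n"
  then have x: "x \<in> periodic_points X f" "period f x \<le> n"
    by (auto simp: periodic_points_upto_def)
  then have "period f x dvd fact n"
    using funpow_period by (intro dvd_fact) (auto simp: Suc_le_eq)
  then have "(f ^^ fact n) x = x"
    using funpow_fixpoint_mult[OF funpow_period(2)[OF x(1)]] by (auto elim: dvdE)
  with x show "x \<in> {x\<in>X. (f ^^ fact n) x = x}"
    by (auto simp: periodic_points_def)
qed

section \<open>Density and empty interior in the subspace topology\<close>

theorem mainTheorem3:
  fixes X :: "real set" and f :: "real \<Rightarrow> real"
  assumes "is_interval X" and "\<exists>a\<in>X. \<exists>b\<in>X. a < b"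
    and "f \<in> X \<rightarrow> X"
    and "continuous_on X f"
    and "topologically_transitive (top_of_set X) f"
  shows "top_of_set X closure_of periodic_points X f = X
    \<and> top_of_set X interior_of periodic_points X f = {}
    \<and> (\<forall>n>0. top_of_set X closure_of (periodic_points X f - periodic_points_upto X f n) = X)"
proof -
  have meets: "periodic_points X f \<inter> V \<noteq> {}" if V: "openin (top_of_set X) V" "V \<noteq> {}" for V
  proof -
    obtain c d where cd: "c < d" "{c..d} \<subseteq> V"
      using openin_interval_contains_Icc[OF assms(1,2) V] .
    then have "{c<..<d} \<subseteq> V"
      by auto
    moreover from this have "{c<..<d} \<subseteq> X"
      using openin_imp_subset[OF V(1)] by blast
    ultimately show ?thesis
      using transitive_interval_has_periodic_point[OF assms(3-5) cd(1)] by blast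
  qed
  have interior: "\<not> V \<subseteq> periodic_points X f" if V: "openin (top_of_set X) V" "V \<noteq> {}" for V
  proof -
    obtain c d where "c < d" "{c..d} \<subseteq> V"
      using openin_interval_contains_Icc[OF assms(1,2) V] .
    then show ?thesis
      using transitive_not_all_periodic[OF assms(3-5), of c d] openin_imp_subset[OF V(1)]
      by blast
  qed
  have meets': "(periodic_points X f - periodic_points_upto X f n) \<inter> V \<noteq> {}"
    if V: "openin (top_of_set X) V" "V \<noteq> {}" for V n
  proof -
    define F where "F = {x\<in>X. (f ^^ fact n) x = x}"
    have "continuous_on X (\<lambda>x. (f ^^ fact n) x - x)"
      by (intro continuous_intros continuous_on_funpow assms)
    from continuous_closedin_preimage_constant[OF this, of 0]
    have "closedin (top_of_set X) F"
      by (simp add: F_def)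
    then have "openin (top_of_set X) (V - F)"
      using V(1) by (rule openin_diff[rotated])
    \<comment> \<open>If \<open>V\<close> lay inside \<open>F\<close>, it would consist of periodic
      points, contradicting the empty interior.\<close>
    moreover have "F \<subseteq> periodic_points X f"
      unfolding F_def periodic_points_def using fact_gt_zero[of n] by blast
    then have "V - F \<noteq> {}"
      using interior[OF V] by blast
    \<comment> \<open>A periodic point in the relatively open set \<open>V - F\<close> has period
      above \<open>n\<close>, because \<open>F\<close> contains all those of period at most
      \<open>n\<close>.\<close>
    ultimately show ?thesis
      using meets periodic_points_upto_subset[of X f n] unfolding F_def by blast
  qed
  have dense: "top_of_set X closure_of S = X"
    if "\<And>V. openin (top_of_set X) V \<Longrightarrow> V \<noteq> {} \<Longrightarrow> S \<inter> V \<noteq> {}" for S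
    using dense_intersects_open[of "top_of_set X" S] that by simp
  have "top_of_set X interior_of periodic_points X f = {}"
    using interior unfolding interior_of_eq_empty by blast
  with dense[OF meets] dense[OF meets'] show ?thesis
    by blast
qed

end
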